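(* Let $G=(V,E)$ be a simple connected undirected graph with $n\ge 3$ vertices and vertex degrees $d_1,\dots,d_n$, and let $\lambda_1\ge\lambda_2\ge\dots\ge\lambda_n=0$ be the eigenvalues of its normalized Laplacian matrix. Put $b=n+2\sum_{(i,j)\in E}\frac{1}{d_id_j}$, suppose $b\neq\frac{n^2}{n-1}$, let $h^{*}=\left\lfloor \frac{n^2}{b}\right\rfloor$ and $$Q=\frac{1}{1+h^{*}}\left(n+\sqrt{\frac{b(h^{*}+1)-n^{2}}{h^{*}}}\right).$$ For real $\alpha\ne 0,1$ let $s^{*}_{\alpha}(G)=\sum_{i=1}^{n-1}\lambda_i^{\alpha}$. Then: 1. if $\alpha<0$ or $\alpha>1$, then $$s^{*}_{\alpha}(G)\ \ge\ Q^{\alpha}+\frac{(n-Q)^{\alpha}}{(n-2)^{\alpha-1}};$$ 2. if $0<\alpha<1$, then $$s^{*}_{\alpha}(G)\ \le\ Q^{\alpha}+\frac{(n-Q)^{\alpha}}{(n-2)^{\alpha-1}}.$$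
   Context: The normalized Laplacian of $G$ is $\mathcal{L}(G)=D^{-1/2}(D-A)D^{-1/2}$, where $A$ is the adjacency matrix of $G$ and $D$ is the diagonal matrix of vertex degrees. Since $G$ is connected, $\lambda_{n-1}>0$, so $s^{*}_{\alpha}(G)$ is defined for all real $\alpha$. The sum over $(i,j)\in E$ counts each undirected edge once. *)

theory Defs
  imports
    "Graph_Theory.Digraph_Component"
    "Jordan_Normal_Form.Char_Poly"
    Complex_Main
begin

text \<open>
  Finite simple undirected graphs are the symmetric digraphs of the locale \<^locale>\<open>graph\<close>: every
  undirected edge is a pair of opposite arcs. Hence \<^const>\<open>out_degree\<close> is the vertex degree,
  and \<open>undirected_edges\<close> contains each edge once.
\<close>

definition undirected_edges :: "('a, 'b) pre_digraph \<Rightarrow> 'a set set" where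
  "undirected_edges G = {{u, v} | u v. u \<rightarrow>\<^bsub>G\<^esub> v}"

text \<open>
  In the matrices below, \<open>vs\<close> lists the vertices without repetition; row and column \<open>i\<close>
  belong to the vertex \<open>vs ! i\<close>.
\<close>

definition adjacency_matrix :: "('a, 'b) pre_digraph \<Rightarrow> 'a list \<Rightarrow> real mat" where
  "adjacency_matrix G vs =
     mat (length vs) (length vs) (\<lambda>(i, j). if vs ! i \<rightarrow>\<^bsub>G\<^esub> vs ! j then 1 else 0)"

definition degree_matrix :: "('a, 'b) pre_digraph \<Rightarrow> 'a list \<Rightarrow> real mat" where
  "degree_matrix G vs = mat_diag (length vs) (\<lambda>i. real (out_degree G (vs ! i)))"

definition degree_matrix_inv_sqrt :: "('a, 'b) pre_digraph \<Rightarrow> 'a list \<Rightarrow> real mat" where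
  "degree_matrix_inv_sqrt G vs =
     mat_diag (length vs) (\<lambda>i. real (out_degree G (vs ! i)) powr (- 1 / 2))"

definition normalized_laplacian :: "('a, 'b) pre_digraph \<Rightarrow> 'a list \<Rightarrow> real mat" where
  "normalized_laplacian G vs =
     degree_matrix_inv_sqrt G vs * (degree_matrix G vs - adjacency_matrix G vs)
       * degree_matrix_inv_sqrt G vs"

text \<open>
  Real eigenvalues with algebraic multiplicity, in non-increasing order. A real symmetric
  \<open>n \<times> n\<close> matrix has all its eigenvalues real, so the list then has length \<open>n\<close>.
\<close>

definition eigenvalues_desc :: "real mat \<Rightarrow> real list" where
  "eigenvalues_desc M = rev (sorted_list_of_multiset (proots (char_poly M)))"

text \<open>\<open>nl_eigenvalue G vs i\<close> is the \<open>i\<close>-th largest eigenvalue, counting from \<open>i = 1\<close>.\<close>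

definition nl_eigenvalue :: "('a, 'b) pre_digraph \<Rightarrow> 'a list \<Rightarrow> nat \<Rightarrow> real" where
  "nl_eigenvalue G vs i = eigenvalues_desc (normalized_laplacian G vs) ! (i - 1)"

definition nl_power_sum :: "('a, 'b) pre_digraph \<Rightarrow> 'a list \<Rightarrow> real \<Rightarrow> real" where
  "nl_power_sum G vs \<alpha> = (\<Sum>i = 1..length vs - 1. nl_eigenvalue G vs i powr \<alpha>)"

end

theory Submission
  imports Defs "HOL-Analysis.Convex" "Jordan_Normal_Form.Schur_Decomposition"
begin

text \<open>The nonzero eigenvalues \<open>\<lambda>\<^sub>1 \<ge> \<dots> \<ge> \<lambda>\<^sub>n\<^sub>-\<^sub>1 > 0\<close> have sum \<open>n\<close> (the trace) and sum of
  squares \<open>b\<close> (the trace of the square). Among numbers in \<open>[0, M]\<close> with sum \<open>n\<close> the sum of squares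
  is largest when as many as possible equal \<open>M\<close> and at most one other is nonzero; comparing with
  \<open>b\<close> gives \<open>\<lambda>\<^sub>1 \<ge> Q\<close>, since \<open>Q\<close> is the larger root of \<open>h Q\<^sup>2 + (n - h Q)\<^sup>2 = b\<close>. The power sum is
  then estimated by tangents of \<open>x\<^sup>\<alpha>\<close> at \<open>Q\<close> and at \<open>(n - Q) / (n - 2)\<close>.\<close>

section \<open>Sums of powers of positive reals\<close>

text \<open>The hypothesis on \<open>c\<close> makes the second derivative of
  \<open>c * x powr \<alpha>\<close> nonnegative on the positive reals, so this function is convex
  there and stays above its tangent at \<open>y\<close>.\<close>

lemma powr_tangent:
  fixes c \<alpha> x y :: real
  assumes "c * (\<alpha> * (\<alpha> - 1)) \<ge> 0" "x > 0" "y > 0"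
  shows "c * x powr \<alpha> \<ge> c * (y powr \<alpha> + \<alpha> * y powr (\<alpha> - 1) * (x - y))"
proof -
  have "c * (\<alpha> * y powr (\<alpha> - 1)) * (x - y) \<le> c * x powr \<alpha> - c * y powr \<alpha>"
  proof (rule f''_imp_f'[where C = "{0<..}" and f'' = "\<lambda>t. c * (\<alpha> * (\<alpha> - 1)) * t powr (\<alpha> - 1 - 1)"])
    fix t :: real assume "t \<in> {0<..}"
    then have t: "t > 0" by simp
    show "((\<lambda>t. c * t powr \<alpha>) has_real_derivative c * (\<alpha> * t powr (\<alpha> - 1))) (at t)"
      using t by (auto intro!: derivative_eq_intros)
    show "((\<lambda>t. c * (\<alpha> * t powr (\<alpha> - 1))) has_real_derivative
        c * (\<alpha> * (\<alpha> - 1)) * t powr (\<alpha> - 1 - 1)) (at t)"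
      using t by (auto intro!: derivative_eq_intros)
    show "0 \<le> c * (\<alpha> * (\<alpha> - 1)) * t powr (\<alpha> - 1 - 1)"
      using assms(1) by simp
  qed (use assms in auto)
  then show ?thesis by (simp add: algebra_simps)
qed

text \<open>Greedy packing into \<open>k\<close> full slots of size \<open>M\<close> and a remainder
  \<open>r\<close>. Each new entry is poured into the remainder, which turns into a full slot on
  reaching \<open>M\<close>; neither move decreases the sum of squares.\<close>

lemma sum_squares_le_packed:
  fixes xs :: "real list"
  assumes "M > 0" "\<And>x. x \<in> set xs \<Longrightarrow> 0 \<le> x \<and> x \<le> M"
  shows "\<exists>(k::nat) r. 0 \<le> r \<and> r < M \<and> sum_list xs = real k * M + r
           \<and> (\<Sum>x\<leftarrow>xs. x\<^sup>2) \<le> real k * M\<^sup>2 + r\<^sup>2"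
  using assms(2)
proof (induction xs)
  case Nil
  show ?case using assms(1) by (intro exI[of _ 0]) auto
next
  case (Cons x xs)
  then obtain k :: nat and r where r: "0 \<le> r" "r < M" and s: "sum_list xs = real k * M + r"
    and q: "(\<Sum>x\<leftarrow>xs. x\<^sup>2) \<le> real k * M\<^sup>2 + r\<^sup>2" by force
  have x: "0 \<le> x" "x \<le> M" using Cons.prems by auto
  show ?case
  proof (cases "r + x < M")
    case True
    have "x\<^sup>2 + r\<^sup>2 \<le> (r + x)\<^sup>2" using x r by (simp add: power2_sum)
    then show ?thesis using True r x s q
      by (intro exI[of _ k] exI[of _ "r + x"]) auto
  next
    case False
    \<comment> \<open>Twice this product is the gain in the sum of squares when \<open>x\<close> and
      \<open>r\<close> are replaced by \<open>M\<close> and \<open>r + x - M\<close>.\<close>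
    have "(M - r) * (M - x) \<ge> 0" using x r by simp
    then have "x\<^sup>2 + r\<^sup>2 \<le> M\<^sup>2 + (r + x - M)\<^sup>2"
      by (simp add: power2_eq_square algebra_simps)
    then show ?thesis using False r x s q
      by (intro exI[of _ "Suc k"] exI[of _ "r + x - M"]) (auto simp: algebra_simps)
  qed
qed

text \<open>At most \<open>h\<close> full slots of size \<open>M\<close> fit. With exactly
  \<open>h\<close>, the packed sum of squares gives a quadratic inequality for \<open>M\<close>;
  with fewer, \<open>N \<le> h * M\<close> already makes \<open>M\<close> large enough.\<close>

lemma max_ge_of_sum_and_sum_squares:
  fixes xs :: "real list" and h :: int
  assumes bounds: "\<And>x. x \<in> set xs \<Longrightarrow> 0 \<le> x \<and> x \<le> M"
    and N: "sum_list xs = N" "N > 0" and b: "(\<Sum>x\<leftarrow>xs. x\<^sup>2) = b" "b > 0"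
    and h: "h = \<lfloor>N\<^sup>2 / b\<rfloor>" "h \<ge> 1"
  shows "1 / (1 + real_of_int h) * (N + sqrt ((b * (real_of_int h + 1) - N\<^sup>2) / real_of_int h)) \<le> M"
proof -
  define H where "H = real_of_int h"
  have H1: "H \<ge> 1" using h by (simp add: H_def)
  have hb: "H * b \<le> N\<^sup>2"
  proof -
    have "H \<le> N\<^sup>2 / b" unfolding H_def h by linarith
    then show ?thesis using b by (simp add: field_simps)
  qed
  have hb': "N\<^sup>2 < (H + 1) * b"
  proof -
    have "N\<^sup>2 / b < H + 1" unfolding H_def h by linarith
    then show ?thesis using b by (simp add: field_simps)
  qed
  have "b \<le> M * N"
  proof -
    have "(\<Sum>x\<leftarrow>xs. x\<^sup>2) \<le> (\<Sum>x\<leftarrow>xs. M * x)"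
      using bounds by (intro sum_list_mono) (auto simp: power2_eq_square intro: mult_right_mono)
    then show ?thesis using N b by (simp add: sum_list_const_mult)
  qed
  then have M: "M > 0" using b N by (metis less_le_trans zero_less_mult_pos2)
  \<comment> \<open>After division by \<open>N\<close>, this says that \<open>H + 1\<close> full
    slots would exceed the total; hence \<open>k \<le> h\<close> below.\<close>
  have "N * N < (H + 1) * M * N"
  proof -
    have "(H + 1) * b \<le> (H + 1) * (M * N)" using \<open>b \<le> M * N\<close> H1 by simp
    then show ?thesis using hb' by (simp add: power2_eq_square mult.assoc)
  qed
  then have NM: "N < (H + 1) * M" using N by simp
  obtain k :: nat and r where r: "0 \<le> r" "r < M" and s: "N = real k * M + r"
    and q: "b \<le> real k * M\<^sup>2 + r\<^sup>2"
    using sum_squares_le_packed[of M xs, OF M bounds] unfolding N(1) b(1) by blast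
  have "real k * M < (H + 1) * M" using NM s r by linarith
  then have "real k < H + 1" using M by simp
  then have kh: "int k \<le> h" unfolding H_def by linarith
  \<comment> \<open>The asserted bound, solved for its square root and squared;
    \<open>N < (H + 1) * M\<close> makes this reversible.\<close>
  have key: "b * (H + 1) - N\<^sup>2 \<le> H * ((H + 1) * M - N)\<^sup>2"
  proof (cases "int k = h")
    case True
    then have kH: "real k = H" by (simp add: H_def)
    then have "r = N - H * M" using s by simp
    then have "0 \<le> H * M\<^sup>2 + (N - H * M)\<^sup>2 - b" using q kH by simp
    \<comment> \<open>The factor \<open>H + 1\<close> completes the square in
      \<open>M\<close>.\<close>
    then have "0 \<le> (H + 1) * (H * M\<^sup>2 + (N - H * M)\<^sup>2 - b)" using H1 by simp
    also have "\<dots> = H * ((H + 1) * M - N)\<^sup>2 - (b * (H + 1) - N\<^sup>2)"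
      by (simp add: power2_eq_square algebra_simps)
    finally show ?thesis by simp
  next
    case False
    then have "real k + 1 \<le> H" using kh unfolding H_def by linarith
    then have "(real k + 1) * M \<le> H * M" using M by simp
    then have NHM: "N \<le> H * M" using s r by (simp add: algebra_simps)
    \<comment> \<open>Both sides of \<open>key\<close>, multiplied by \<open>H\<close>, are compared
      with \<open>N\<^sup>2\<close>: the right side through this bound, the left side through
      \<open>H * b \<le> N\<^sup>2\<close>.\<close>
    have "N \<le> H * ((H + 1) * M - N)"
    proof -
      have "(H + 1) * N \<le> (H + 1) * (H * M)" using NHM H1 by simp
      then show ?thesis by (simp add: algebra_simps)
    qed
    then have "N\<^sup>2 \<le> (H * ((H + 1) * M - N))\<^sup>2" using N by (intro power_mono) auto
    then have "N\<^sup>2 \<le> H * (H * ((H + 1) * M - N)\<^sup>2)" by (simp add: power2_eq_square algebra_simps)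
    moreover have "H * (b * (H + 1) - N\<^sup>2) \<le> N\<^sup>2"
    proof -
      have "(H + 1) * (H * b) \<le> (H + 1) * N\<^sup>2" using hb H1 by simp
      then show ?thesis by (simp add: algebra_simps)
    qed
    ultimately have "H * (b * (H + 1) - N\<^sup>2) \<le> H * (H * ((H + 1) * M - N)\<^sup>2)" by simp
    then show ?thesis using H1 by simp
  qed
  have "sqrt ((b * (H + 1) - N\<^sup>2) / H) \<le> (H + 1) * M - N"
  proof (rule real_le_lsqrt)
    show "0 \<le> (H + 1) * M - N" using NM by simp
    show "(b * (H + 1) - N\<^sup>2) / H \<le> ((H + 1) * M - N)\<^sup>2"
      using key H1 by (simp add: field_simps)
  qed
  then have "(N + sqrt ((b * (H + 1) - N\<^sup>2) / H)) / (1 + H) \<le> M"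
    using H1 by (simp add: field_simps)
  then show ?thesis by (simp add: H_def)
qed

section \<open>Sum of squares against the square of the sum\<close>

lemma sum_list_square_lower:
  fixes xs :: "real list"
  shows "(sum_list xs)\<^sup>2 \<le> real (length xs) * (\<Sum>x\<leftarrow>xs. x\<^sup>2)"
proof -
  have "(\<Sum>i\<in>{0..<length xs}. xs ! i * 1)\<^sup>2 \<le> (\<Sum>i\<in>{0..<length xs}. (xs ! i)\<^sup>2) * (\<Sum>i\<in>{0..<length xs}. 1\<^sup>2)"
    by (rule Cauchy_Schwarz_ineq_sum)
  then show ?thesis by (simp add: sum_list_sum_nth mult.commute)
qed

lemma sum_list_square_upper:
  fixes xs :: "real list"
  assumes "\<And>x. x \<in> set xs \<Longrightarrow> x \<ge> 0"
  shows "(\<Sum>x\<leftarrow>xs. x\<^sup>2) \<le> (sum_list xs)\<^sup>2"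
  using assms
proof (induction xs)
  case (Cons x xs)
  have "0 \<le> x * sum_list xs" using Cons.prems by (auto intro!: mult_nonneg_nonneg sum_list_nonneg)
  moreover have "(\<Sum>x\<leftarrow>xs. x\<^sup>2) \<le> (sum_list xs)\<^sup>2" using Cons by auto
  ultimately show ?case by (simp add: power2_sum)
qed auto

text \<open>The factor \<open>c = \<plusminus>1\<close> treats the convex and the concave exponents together. The entries are
  compared with the tangents of \<open>x\<^sup>\<alpha>\<close> at \<open>Q\<close> (for the largest entry) and at
  \<open>(N - Q) / m\<close> (for the others); the slopes are ordered because \<open>(N - Q) / m \<le> Q\<close>.\<close>

lemma powr_sum_bound_of_max_ge:
  fixes zs :: "real list" and c \<alpha> M N Q :: real
  assumes c: "c * (\<alpha> * (\<alpha> - 1)) \<ge> 0"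
    and pos: "M > 0" "\<And>z. z \<in> set zs \<Longrightarrow> z > 0" and zs: "zs \<noteq> []"
    and N: "M + sum_list zs = N" and m: "m = real (length zs)"
    and Q: "N / (m + 1) \<le> Q" "Q \<le> M"
  shows "c * (Q powr \<alpha> + (N - Q) powr \<alpha> / m powr (\<alpha> - 1)) \<le> c * (\<Sum>x\<leftarrow>M # zs. x powr \<alpha>)"
proof -
  define R where "R = (N - Q) / m"
  have m0: "m > 0" using zs m by simp
  have "sum_list zs > 0"
  proof -
    obtain z zs' where z: "zs = z # zs'" using zs by (cases zs) auto
    have "sum_list zs' \<ge> 0" using pos z by (intro sum_list_nonneg) (auto intro: less_imp_le)
    moreover have "z > 0" using pos z by simp
    ultimately show ?thesis using z by simp
  qed
  then have N0: "N > 0" "N > Q" using N Q pos by auto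
  then have R0: "R > 0" using m0 by (simp add: R_def)
  have Q0: "Q > 0" using Q(1) N0 m0 by (smt (verit) divide_pos_pos)
  \<comment> \<open>\<open>Q\<close> is at least the mean of all \<open>m + 1\<close> entries, so
    spreading \<open>N - Q\<close> over the other \<open>m\<close> gives at most \<open>Q\<close>
    each.\<close>
  have RQ: "R \<le> Q" using Q(1) m0 by (simp add: R_def field_simps)
  \<comment> \<open>All tangents are taken at the same point \<open>R\<close>, so their sum depends
    only on the length and the sum of \<open>ys\<close>.\<close>
  have rest: "c * (\<Sum>x\<leftarrow>ys. x powr \<alpha>)
      \<ge> c * (real (length ys) * R powr \<alpha> + \<alpha> * R powr (\<alpha> - 1) * (sum_list ys - real (length ys) * R))"
    if "\<And>z. z \<in> set ys \<Longrightarrow> z > 0" for ys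
    using that
  proof (induction ys)
    case (Cons y ys)
    have "c * y powr \<alpha> \<ge> c * (R powr \<alpha> + \<alpha> * R powr (\<alpha> - 1) * (y - R))"
      using Cons.prems R0 by (intro powr_tangent[OF c]) auto
    moreover have "c * (\<Sum>x\<leftarrow>ys. x powr \<alpha>)
      \<ge> c * (real (length ys) * R powr \<alpha> + \<alpha> * R powr (\<alpha> - 1) * (sum_list ys - real (length ys) * R))"
      using Cons by auto
    ultimately show ?case by (simp add: algebra_simps)
  qed auto
  have top: "c * M powr \<alpha> \<ge> c * (Q powr \<alpha> + \<alpha> * Q powr (\<alpha> - 1) * (M - Q))"
    by (rule powr_tangent[OF c pos(1) Q0])
  \<comment> \<open>The derivative of the convex function \<open>c * x powr \<alpha>\<close> is at
    least as large at \<open>Q\<close> as at \<open>R\<close>. For \<open>\<alpha> = 1\<close> both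
    powers are 1, whatever the sign of \<open>c\<close>.\<close>
  have slope: "c * \<alpha> * (Q powr (\<alpha> - 1) - R powr (\<alpha> - 1)) \<ge> 0"
  proof (cases "\<alpha> \<ge> 1")
    case True
    have "c * \<alpha> \<ge> 0 \<or> \<alpha> = 1" using c True
      by (smt (verit) mult.assoc mult_le_0_iff zero_le_mult_iff)
    moreover have "Q powr (\<alpha> - 1) \<ge> R powr (\<alpha> - 1)" using True RQ R0 by (intro powr_mono2) auto
    ultimately show ?thesis using Q0 R0 by auto
  next
    case False
    have "c * \<alpha> \<le> 0" using c False
      by (smt (verit) mult.assoc mult_pos_neg mult_neg_pos)
    moreover have "Q powr (\<alpha> - 1) \<le> R powr (\<alpha> - 1)" using False RQ R0
      by (intro powr_mono2') auto
    ultimately show ?thesis by (simp add: mult_nonpos_nonpos)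
  qed
  \<comment> \<open>The excess of \<open>M\<close> over \<open>Q\<close> is what the other entries
    lack to \<open>m * R\<close>, so the linear tangent terms merge into the slope difference times
    \<open>M - Q\<close>.\<close>
  have sumzs: "sum_list zs - m * R = Q - M" using N m0 by (simp add: R_def)
  have mR: "(N - Q) powr \<alpha> / m powr (\<alpha> - 1) = m * R powr \<alpha>"
    using N0 m0 by (simp add: R_def powr_divide powr_diff)
  have "c * (Q powr \<alpha> + m * R powr \<alpha>) + c * \<alpha> * (Q powr (\<alpha> - 1) - R powr (\<alpha> - 1)) * (M - Q)
      \<le> c * (\<Sum>x\<leftarrow>M # zs. x powr \<alpha>)"
    using top rest[of zs] pos(2) unfolding m[symmetric] sumzs by (simp add: algebra_simps)
  moreover have "c * \<alpha> * (Q powr (\<alpha> - 1) - R powr (\<alpha> - 1)) * (M - Q) \<ge> 0"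
    using slope Q(2) by simp
  ultimately show ?thesis unfolding mR by linarith
qed

section \<open>Spectra of symmetric matrices\<close>

lemma mult_mat_vec_index_sum:
  assumes "A \<in> carrier_mat n m" "v \<in> carrier_vec m" "i < n"
  shows "(A *\<^sub>v v) $ i = (\<Sum>j = 0..<m. A $$ (i, j) * v $ j)"
  using assms by (auto simp: scalar_prod_def intro!: sum.cong)

lemma mult_mat_index_sum:
  assumes "A \<in> carrier_mat n m" "B \<in> carrier_mat m l" "i < n" "j < l"
  shows "(A * B) $$ (i, j) = (\<Sum>k = 0..<m. A $$ (i, k) * B $$ (k, j))"
  using assms by (auto simp: scalar_prod_def intro!: sum.cong)

text \<open>Exchanging the two summations (cyclicity of the trace) brings \<open>Q\<close> and
  \<open>P\<close> together, where they cancel.\<close>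

lemma trace_similar:
  fixes A :: "'a :: comm_ring_1 mat"
  assumes "A \<in> carrier_mat n n" "similar_mat_wit A B P Q"
  shows "(\<Sum>i = 0..<n. A $$ (i, i)) = (\<Sum>i = 0..<n. B $$ (i, i))"
proof -
  note w = similar_mat_witD2[OF assms]
  have PB: "P * B \<in> carrier_mat n n" using w by auto
  have "(\<Sum>i = 0..<n. A $$ (i, i)) = (\<Sum>i = 0..<n. \<Sum>k = 0..<n. (P * B) $$ (i, k) * Q $$ (k, i))"
    unfolding w(3) using PB w by (intro sum.cong refl mult_mat_index_sum) auto
  also have "\<dots> = (\<Sum>k = 0..<n. \<Sum>i = 0..<n. Q $$ (k, i) * (P * B) $$ (i, k))"
    by (subst sum.swap) (simp add: mult.commute)
  also have "\<dots> = (\<Sum>k = 0..<n. (Q * (P * B)) $$ (k, k))"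
    using PB w by (intro sum.cong refl mult_mat_index_sum[symmetric]) auto
  also have "Q * (P * B) = B" using w by (simp flip: assoc_mult_mat)
  finally show ?thesis .
qed

text \<open>A Schur form carries the roots \<open>es\<close> on its diagonal. The same
  \<open>P\<close> and \<open>Q\<close> relate \<open>A * A\<close> to \<open>B * B\<close>, so both
  sums are traces that can be read off a triangular matrix.\<close>

lemma
  fixes A :: "'a :: conjugatable_ordered_field mat"
  assumes A: "A \<in> carrier_mat n n" and cp: "char_poly A = (\<Prod>e\<leftarrow>es. [:- e, 1:])"
  shows sum_char_poly_roots: "sum_list es = (\<Sum>i = 0..<n. A $$ (i, i))"
    and sum_squares_char_poly_roots:
      "(\<Sum>e\<leftarrow>es. e\<^sup>2) = (\<Sum>i = 0..<n. \<Sum>j = 0..<n. A $$ (i, j) * A $$ (j, i))"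
proof -
  obtain B P Q where "schur_decomposition A es = (B, P, Q)" by (metis prod_cases3)
  from schur_decomposition[OF A cp this]
  have sim: "similar_mat_wit A B P Q" and ut: "upper_triangular B" and es: "diag_mat B = es" by auto
  note w = similar_mat_witD2[OF A sim]
  have es: "es = map (\<lambda>i. B $$ (i, i)) [0..<n]"
    using es w(5) unfolding diag_mat_def by auto
  show "sum_list es = (\<Sum>i = 0..<n. A $$ (i, i))"
    unfolding trace_similar[OF A sim] es by (simp add: interv_sum_list_conv_sum_set_nat)
  have "similar_mat_wit (A * A) (B * B) P Q"
  proof (rule similar_mat_witI[OF w(1,2)])
    have "A * A = P * B * (Q * P) * (B * Q)"
      unfolding w(3) using w(5-7) by (simp add: assoc_mult_mat[of _ n n _ n _ n])
    also have "\<dots> = P * (B * B) * Q"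
      unfolding w(2) using w(5-7) by (simp add: assoc_mult_mat[of _ n n _ n _ n])
    finally show "A * A = P * (B * B) * Q" .
  qed (use w in auto)
  then have "(\<Sum>i = 0..<n. (A * A) $$ (i, i)) = (\<Sum>i = 0..<n. (B * B) $$ (i, i))"
    using A by (intro trace_similar) auto
  also have "\<dots> = (\<Sum>i = 0..<n. (B $$ (i, i))\<^sup>2)"
  proof (intro sum.cong refl)
    fix i assume i: "i \<in> {0..<n}"
    have "(B * B) $$ (i, i) = (\<Sum>k = 0..<n. B $$ (i, k) * B $$ (k, i))"
      using i w(5) by (intro mult_mat_index_sum) auto
    \<comment> \<open>For \<open>k \<noteq> i\<close> one of the two factors lies below the
      diagonal.\<close>
    also have "\<dots> = (\<Sum>k = 0..<n. if k = i then (B $$ (i, i))\<^sup>2 else 0)"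
    proof (intro sum.cong refl)
      fix k assume k: "k \<in> {0..<n}"
      show "B $$ (i, k) * B $$ (k, i) = (if k = i then (B $$ (i, i))\<^sup>2 else 0)"
        using upper_triangularD[OF ut, of k i] upper_triangularD[OF ut, of i k] i k w(5)
        by (cases k i rule: linorder_cases) (auto simp: power2_eq_square)
    qed
    also have "\<dots> = (B $$ (i, i))\<^sup>2" using i by simp
    finally show "(B * B) $$ (i, i) = (B $$ (i, i))\<^sup>2" .
  qed
  also have "\<dots> = (\<Sum>e\<leftarrow>es. e\<^sup>2)"
    unfolding es by (simp add: interv_sum_list_conv_sum_set_nat o_def)
  finally show "(\<Sum>e\<leftarrow>es. e\<^sup>2) = (\<Sum>i = 0..<n. \<Sum>j = 0..<n. A $$ (i, j) * A $$ (j, i))"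
    using mult_mat_index_sum[OF A A] by simp
qed

text \<open>The Hermitian form \<open>S\<close> of an eigenvector is fixed by conjugation because
  \<open>A\<close> is real and symmetric, and it equals \<open>\<mu>\<close> times the positive real
  \<open>T\<close>.\<close>

lemma symmetric_eigenvalue_Reals:
  fixes A :: "real mat"
  assumes A: "A \<in> carrier_mat n n"
    and sym: "\<And>i j. i < n \<Longrightarrow> j < n \<Longrightarrow> A $$ (i, j) = A $$ (j, i)"
    and ev: "eigenvalue (map_mat complex_of_real A) \<mu>"
  shows "\<mu> \<in> \<real>"
proof -
  let ?A = "map_mat complex_of_real A"
  from ev obtain v where v: "v \<in> carrier_vec n" "v \<noteq> 0\<^sub>v n" "?A *\<^sub>v v = \<mu> \<cdot>\<^sub>v v"
    using A unfolding eigenvalue_def eigenvector_def by auto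
  define S where "S = (\<Sum>i = 0..<n. \<Sum>j = 0..<n. complex_of_real (A $$ (i, j)) * v $ j * cnj (v $ i))"
  have row: "(\<Sum>j = 0..<n. complex_of_real (A $$ (i, j)) * v $ j) = \<mu> * v $ i" if "i < n" for i
  proof -
    have "(?A *\<^sub>v v) $ i = (\<Sum>j = 0..<n. ?A $$ (i, j) * v $ j)"
      using A v that by (intro mult_mat_vec_index_sum) auto
    also have "\<dots> = (\<Sum>j = 0..<n. complex_of_real (A $$ (i, j)) * v $ j)"
      using A that by (intro sum.cong) auto
    finally show ?thesis using v that by simp
  qed
  have "cnj S = (\<Sum>i = 0..<n. \<Sum>j = 0..<n. complex_of_real (A $$ (i, j)) * cnj (v $ j) * v $ i)"
    by (simp add: S_def)
  also have "\<dots> = (\<Sum>j = 0..<n. \<Sum>i = 0..<n. complex_of_real (A $$ (j, i)) * v $ i * cnj (v $ j))"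
    by (subst sum.swap) (intro sum.cong refl, simp add: sym mult_ac)
  finally have "cnj S = S" by (simp add: S_def)
  then have S: "S \<in> \<real>" by (simp add: complex_is_Real_iff complex_eq_iff)
  define T where "T = (\<Sum>i = 0..<n. (cmod (v $ i))\<^sup>2)"
  have "S = (\<Sum>i = 0..<n. \<mu> * v $ i * cnj (v $ i))"
    unfolding S_def by (intro sum.cong refl) (simp add: row flip: sum_distrib_right)
  also have "\<dots> = \<mu> * complex_of_real T"
    by (simp add: T_def sum_distrib_left mult.assoc flip: complex_norm_square)
  finally have ST: "S = \<mu> * complex_of_real T" .
  obtain i where "i < n" "v $ i \<noteq> 0" using v(1,2) by (metis eq_vecI carrier_vecD index_zero_vec)
  then have "T > 0" unfolding T_def by (intro sum_pos2[of _ i]) auto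
  then have "\<mu> = S / complex_of_real T" using ST by simp
  then show ?thesis using S by simp
qed

text \<open>Over the complex numbers the polynomial splits, with real roots; the factorization
  descends because real polynomials embed injectively into complex ones.\<close>

lemma symmetric_char_poly_splits:
  fixes A :: "real mat"
  assumes A: "A \<in> carrier_mat n n"
    and sym: "\<And>i j. i < n \<Longrightarrow> j < n \<Longrightarrow> A $$ (i, j) = A $$ (j, i)"
  shows "\<exists>es. char_poly A = (\<Prod>e\<leftarrow>es. [:- e, 1:]) \<and> length es = n"
proof -
  let ?A = "map_mat complex_of_real A"
  interpret of_real_poly_hom: map_poly_inj_idom_hom complex_of_real ..
  have A': "?A \<in> carrier_mat n n" using A by simp
  obtain cs where cs: "char_poly ?A = (\<Prod>c\<leftarrow>cs. [:- c, 1:])" "length cs = n"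
    using char_poly_factorized[OF A'] by blast
  have real: "c \<in> \<real>" if "c \<in> set cs" for c
  proof -
    have "poly (char_poly ?A) c = 0"
      unfolding cs(1) using that by (induction cs) auto
    then show ?thesis
      using symmetric_eigenvalue_Reals[OF A sym] eigenvalue_root_char_poly[OF A'] by blast
  qed
  have "char_poly ?A = map_poly complex_of_real (char_poly A)"
    by (rule of_real_hom.char_poly_hom[OF A])
  then have "map_poly complex_of_real (char_poly A) = (\<Prod>c\<leftarrow>cs. [:- c, 1:])"
    unfolding cs(1) by simp
  also have "\<dots> = map_poly complex_of_real (\<Prod>e\<leftarrow>map Re cs. [:- e, 1:])"
    using real
  proof (induction cs)
    case (Cons c cs)
    have "complex_of_real (Re c) = c" using Cons.prems by (simp add: of_real_Re)
    then have "map_poly complex_of_real [:- Re c, 1:] = [:- c, 1:]"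
      by (simp add: map_poly_pCons)
    then show ?case using Cons by (simp add: of_real_poly_hom.hom_mult del: mult_pCons_left)
  qed simp
  finally have "char_poly A = (\<Prod>e\<leftarrow>map Re cs. [:- e, 1:])"
    by (metis of_real_poly_hom.injectivity)
  then show ?thesis using cs(2) by (metis length_map)
qed

lemma proots_prod_linear:
  "proots (\<Prod>e\<leftarrow>es. [:- e, 1:]) = mset (es :: 'a :: idom list)"
proof (induction es)
  case (Cons e es)
  have "(\<Prod>e\<leftarrow>es. [:- e, 1:]) \<noteq> 0" by (auto simp: prod_list_zero_iff)
  then show ?case using Cons
    by (simp add: proots_mult del: mult_pCons_left)
qed simp

text \<open>Because the characteristic polynomial splits over the reals, its real roots account for
  all \<open>n\<close> linear factors, and sorting them only permutes the product.\<close>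

lemma
  fixes A :: "real mat"
  assumes A: "A \<in> carrier_mat n n"
    and sym: "\<And>i j. i < n \<Longrightarrow> j < n \<Longrightarrow> A $$ (i, j) = A $$ (j, i)"
  shows char_poly_eigenvalues_desc: "char_poly A = (\<Prod>e\<leftarrow>eigenvalues_desc A. [:- e, 1:])"
    and length_eigenvalues_desc: "length (eigenvalues_desc A) = n"
    and set_eigenvalues_desc: "set (eigenvalues_desc A) = {e. eigenvalue A e}"
proof -
  obtain es where es: "char_poly A = (\<Prod>e\<leftarrow>es. [:- e, 1:])" "length es = n"
    using symmetric_char_poly_splits[OF assms] by blast
  have m: "mset (eigenvalues_desc A) = mset es"
    unfolding eigenvalues_desc_def es(1) proots_prod_linear by simp
  show "length (eigenvalues_desc A) = n" using m es(2) by (metis size_mset)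
  show cp: "char_poly A = (\<Prod>e\<leftarrow>eigenvalues_desc A. [:- e, 1:])"
    using m unfolding es(1) by (metis mset_map prod_mset_prod_list)
  show "set (eigenvalues_desc A) = {e. eigenvalue A e}"
    unfolding eigenvalue_root_char_poly[OF A] cp
    by (auto simp: poly_prod_list prod_list_zero_iff)
qed

text \<open>Symmetry turns the squared norm of \<open>A *\<^sub>v v\<close> into the scalar product
  of \<open>v\<close> with \<open>A *\<^sub>v (A *\<^sub>v v)\<close>, which vanishes.\<close>

lemma symmetric_kernel_square:
  fixes A :: "real mat"
  assumes A: "A \<in> carrier_mat n n" and v: "v \<in> carrier_vec n"
    and sym: "\<And>i j. i < n \<Longrightarrow> j < n \<Longrightarrow> A $$ (i, j) = A $$ (j, i)"
    and AAv: "A *\<^sub>v (A *\<^sub>v v) = 0\<^sub>v n"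
  shows "A *\<^sub>v v = 0\<^sub>v n"
proof -
  define w where "w = A *\<^sub>v v"
  have w: "w \<in> carrier_vec n" using A v by (simp add: w_def)
  have wi: "w $ i = (\<Sum>j = 0..<n. A $$ (i, j) * v $ j)" if "i < n" for i
    unfolding w_def by (rule mult_mat_vec_index_sum[OF A v that])
  have "(\<Sum>i = 0..<n. (w $ i)\<^sup>2) = (\<Sum>i = 0..<n. \<Sum>j = 0..<n. w $ i * (A $$ (i, j) * v $ j))"
    by (intro sum.cong refl) (simp add: wi power2_eq_square sum_distrib_left)
  also have "\<dots> = (\<Sum>j = 0..<n. \<Sum>i = 0..<n. v $ j * (A $$ (j, i) * w $ i))"
    by (subst sum.swap) (intro sum.cong refl, simp add: sym mult_ac)
  also have "\<dots> = (\<Sum>j = 0..<n. v $ j * (A *\<^sub>v w) $ j)"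
    by (intro sum.cong refl) (simp add: mult_mat_vec_index_sum[OF A w] sum_distrib_left del: index_mult_mat_vec)
  also have "\<dots> = 0" using AAv by (simp add: w_def del: index_mult_mat_vec)
  finally have "\<forall>i \<in> {0..<n}. (w $ i)\<^sup>2 = 0"
    by (subst (asm) sum_nonneg_eq_0_iff) auto
  then show ?thesis unfolding w_def[symmetric] using w by (intro eq_vecI) auto
qed

text \<open>In a Schur form with both zeros placed first, the first two columns of the transformation
  matrix are killed by \<open>A\<^sup>2\<close>, hence by \<open>A\<close> itself because \<open>A\<close> is symmetric.\<close>

lemma symmetric_zero_root_simple:
  fixes A :: "real mat"
  assumes A: "A \<in> carrier_mat n n"
    and sym: "\<And>i j. i < n \<Longrightarrow> j < n \<Longrightarrow> A $$ (i, j) = A $$ (j, i)"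
    and ker: "\<And>v. v \<in> carrier_vec n \<Longrightarrow> A *\<^sub>v v = 0\<^sub>v n \<Longrightarrow> \<exists>c. v = c \<cdot>\<^sub>v w"
    and w: "w \<in> carrier_vec n"
  shows "char_poly A \<noteq> (\<Prod>e\<leftarrow>0 # 0 # es. [:- e, 1:])"
proof
  assume cp: "char_poly A = (\<Prod>e\<leftarrow>0 # 0 # es. [:- e, 1:])"
  obtain B P Q where "schur_decomposition A (0 # 0 # es) = (B, P, Q)" by (metis prod_cases3)
  from schur_decomposition[OF A cp this]
  have sim: "similar_mat_wit A B P Q" and ut: "upper_triangular B" and es: "diag_mat B = 0 # 0 # es"
    by auto
  note c = similar_mat_witD2[OF A sim]
  have "length (diag_mat B) = n" using c(5) by (simp add: diag_mat_def)
  then have n: "n \<ge> 2" using es by simp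
  have B00: "B $$ (0, 0) = 0" "B $$ (1, 1) = 0"
    using arg_cong[OF es, of "\<lambda>l. l ! 0"] arg_cong[OF es, of "\<lambda>l. l ! 1"] n c(5)
    by (simp_all add: diag_mat_def)
  have "A * P = P * B * (Q * P)" unfolding c(3) using c(5-7) by (simp add: assoc_mult_mat[of _ n n _ n _ n])
  then have AP: "A * P = P * B" using c by simp
  have colAP: "A *\<^sub>v col P j = P *\<^sub>v col B j" if "j < n" for j
  proof -
    have "col (A * P) j = A *\<^sub>v col P j" using c that by (intro col_mult2) auto
    moreover have "col (P * B) j = P *\<^sub>v col B j" using c that by (intro col_mult2) auto
    ultimately show ?thesis using AP by simp
  qed
  have P0: "col P 0 \<in> carrier_vec n" "col P 1 \<in> carrier_vec n" using c n by auto
  have "col B 0 = 0\<^sub>v n"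
    using c(5) n B00 upper_triangularD[OF ut, of 0] by (intro eq_vecI) (auto, metis gr0I)
  then have A0: "A *\<^sub>v col P 0 = 0\<^sub>v n" using colAP[of 0] n c(6) by (intro eq_vecI) auto
  \<comment> \<open>The diagonal entry of this column is zero, so only \<open>B $$ (0, 1)\<close>
    can remain; hence \<open>A\<close> maps the second column of \<open>P\<close> to a multiple of
    the first, which \<open>A\<close> kills.\<close>
  have "col B 1 = B $$ (0, 1) \<cdot>\<^sub>v unit_vec n 0"
  proof (intro eq_vecI)
    fix i assume "i < dim_vec (B $$ (0, 1) \<cdot>\<^sub>v unit_vec n 0)"
    then have i: "i < n" by simp
    show "col B 1 $ i = (B $$ (0, 1) \<cdot>\<^sub>v unit_vec n 0) $ i"
      using i n c(5) B00 upper_triangularD[OF ut, of 1 i]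
      by (cases "i = 0"; cases "i = 1") auto
  qed (use c in auto)
  then have "A *\<^sub>v col P 1 = P *\<^sub>v (B $$ (0, 1) \<cdot>\<^sub>v unit_vec n 0)" using colAP[of 1] n by simp
  also have "\<dots> = B $$ (0, 1) \<cdot>\<^sub>v (P *\<^sub>v unit_vec n 0)"
    using c(6) by (intro mult_mat_vec) auto
  also have "P *\<^sub>v unit_vec n 0 = col P 0" using c(6) n by (intro eq_vecI) auto
  finally have "A *\<^sub>v (A *\<^sub>v col P 1) = A *\<^sub>v (B $$ (0, 1) \<cdot>\<^sub>v col P 0)" by simp
  also have "\<dots> = B $$ (0, 1) \<cdot>\<^sub>v (A *\<^sub>v col P 0)" using A P0(1) by (intro mult_mat_vec)
  also have "\<dots> = 0\<^sub>v n" using A0 by (intro eq_vecI) auto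
  finally have A1: "A *\<^sub>v col P 1 = 0\<^sub>v n" using symmetric_kernel_square[OF A P0(2) sym] by blast
  from ker[OF P0(1) A0] ker[OF P0(2) A1] obtain a b where
    ab: "col P 0 = a \<cdot>\<^sub>v w" "col P 1 = b \<cdot>\<^sub>v w" by blast
  \<comment> \<open>Two multiples of one vector cannot both be columns of the invertible
    \<open>P\<close>: tested against rows of the inverse \<open>Q\<close>, they force
    \<open>b = 0\<close> and \<open>b \<noteq> 0\<close>.\<close>
  have QP: "row Q i \<bullet> col P j = (if i = j then 1 else 0)" if "i < n" "j < n" for i j
    using arg_cong[OF c(2), of "\<lambda>M. M $$ (i, j)"] that c(6,7) by simp
  have rQ: "row Q i \<in> carrier_vec n" if "i < n" for i using c(7) that by auto
  have "a * (row Q 0 \<bullet> w) = 1" "b * (row Q 0 \<bullet> w) = 0" "b * (row Q 1 \<bullet> w) = 1"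
    using QP[of 0 0] QP[of 0 1] QP[of 1 1] n rQ[of 0] rQ[of 1] w unfolding ab by auto
  then show False by auto
qed

section \<open>The normalized Laplacian\<close>

text \<open>The left side is the quadratic form of the Laplacian with symmetric edge weights
  \<open>a\<close>. After expanding the square, symmetry identifies the two pure square sums;
  ordered pairs meet each edge twice, whence the division by 2.\<close>

lemma laplacian_quadratic_form:
  fixes a :: "nat \<Rightarrow> nat \<Rightarrow> real"
  assumes "\<And>i j. i < n \<Longrightarrow> j < n \<Longrightarrow> a i j = a j i"
  shows "(\<Sum>i = 0..<n. u i * (\<Sum>j = 0..<n. ((if i = j then \<Sum>k = 0..<n. a i k else 0) - a i j) * u j))
       = (\<Sum>i = 0..<n. \<Sum>j = 0..<n. a i j * (u i - u j)\<^sup>2) / 2"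
proof -
  define S where "S = (\<Sum>i = 0..<n. \<Sum>j = 0..<n. a i j * (u i)\<^sup>2)"
  define T where "T = (\<Sum>i = 0..<n. \<Sum>j = 0..<n. a i j * (u i * u j))"
  have "(\<Sum>j = 0..<n. ((if i = j then \<Sum>k = 0..<n. a i k else 0) - a i j) * u j)
      = (\<Sum>k = 0..<n. a i k) * u i - (\<Sum>j = 0..<n. a i j * u j)" if "i < n" for i
  proof -
    have "(\<Sum>j = 0..<n. ((if i = j then \<Sum>k = 0..<n. a i k else 0) - a i j) * u j)
        = (\<Sum>j = 0..<n. if j = i then (\<Sum>k = 0..<n. a i k) * u i else 0) - (\<Sum>j = 0..<n. a i j * u j)"
      unfolding sum_subtractf[symmetric] by (intro sum.cong) (auto simp: algebra_simps)
    then show ?thesis using that by simp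
  qed
  then have "(\<Sum>i = 0..<n. u i * (\<Sum>j = 0..<n. ((if i = j then \<Sum>k = 0..<n. a i k else 0) - a i j) * u j))
      = (\<Sum>i = 0..<n. u i * ((\<Sum>k = 0..<n. a i k) * u i - (\<Sum>j = 0..<n. a i j * u j)))"
    by (intro sum.cong) auto
  also have "\<dots> = S - T"
    by (simp add: S_def T_def right_diff_distrib sum_subtractf sum_distrib_left sum_distrib_right
        power2_eq_square mult_ac)
  finally have L: "(\<Sum>i = 0..<n. u i * (\<Sum>j = 0..<n. ((if i = j then \<Sum>k = 0..<n. a i k else 0) - a i j) * u j))
      = S - T" .
  have S': "S = (\<Sum>i = 0..<n. \<Sum>j = 0..<n. a i j * (u j)\<^sup>2)"
    unfolding S_def by (subst sum.swap) (intro sum.cong refl, simp add: assms)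
  have "(\<Sum>i = 0..<n. \<Sum>j = 0..<n. a i j * (u i - u j)\<^sup>2)
      = (\<Sum>i = 0..<n. \<Sum>j = 0..<n. a i j * (u i)\<^sup>2 + a i j * (u j)\<^sup>2 - 2 * (a i j * (u i * u j)))"
    by (intro sum.cong refl) (simp add: power2_eq_square algebra_simps)
  also have "\<dots> = S + S - 2 * T"
    unfolding sum_subtractf sum.distrib S'[symmetric] S_def[symmetric]
    by (simp add: T_def sum_distrib_left)
  finally show ?thesis using L by simp
qed

text \<open>With at least two vertices, connectedness excludes isolated vertices, so all degrees are
  positive.\<close>

locale enumerated_connected_graph = graph G for G :: "('a, 'b) pre_digraph" +
  fixes vs :: "'a list"
  assumes connected: "Digraph_Component.connected G"
    and distinct: "distinct vs" and set_vs: "set vs = verts G"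
    and length_ge_2: "length vs \<ge> 2"
begin

abbreviation deg :: "nat \<Rightarrow> real" where "deg i \<equiv> real (out_degree G (vs ! i))"

abbreviation adj :: "nat \<Rightarrow> nat \<Rightarrow> real" where "adj i j \<equiv> (if vs ! i \<rightarrow>\<^bsub>G\<^esub> vs ! j then 1 else 0)"

abbreviation L :: "real mat" where "L \<equiv> normalized_laplacian G vs"

lemma sum_nth_eq_sum_verts: "(\<Sum>i = 0..<length vs. f (vs ! i)) = (\<Sum>v\<in>verts G. f v)"
  using sum.reindex_bij_betw[OF bij_betw_nth[OF distinct, of "{0..<length vs}" "verts G"]]
  by (simp add: set_vs atLeast0LessThan)

lemma adjacent_commute: "u \<rightarrow>\<^bsub>G\<^esub> v \<longleftrightarrow> v \<rightarrow>\<^bsub>G\<^esub> u"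
  using arcs_ends_symmetric[OF sym_arcs] by metis

text \<open>There are no parallel arcs, so \<open>head\<close> is injective on the arcs leaving
  \<open>u\<close>.\<close>

lemma out_degree_eq_card: "out_degree G u = card {v \<in> verts G. u \<rightarrow>\<^bsub>G\<^esub> v}"
proof -
  have "inj_on (head G) (out_arcs G u)"
    by (intro inj_onI no_multi_arcs) (auto simp: arc_to_ends_def)
  moreover have "head G ` out_arcs G u = {v \<in> verts G. u \<rightarrow>\<^bsub>G\<^esub> v}"
    by (force simp: arcs_ends_conv)
  ultimately show ?thesis unfolding out_degree_def by (metis card_image)
qed

lemma deg_eq_sum_adj: "deg i = (\<Sum>j = 0..<length vs. adj i j)"
  unfolding sum_nth_eq_sum_verts[of "\<lambda>v. if vs ! i \<rightarrow>\<^bsub>G\<^esub> v then 1 else 0"] out_degree_eq_card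
  by (simp add: sum.If_cases Int_def)

text \<open>Connectedness refers to the symmetric closure, whose reachability agrees with that of
  \<open>G\<close> because the arcs are symmetric.\<close>

lemma reachable: "u \<in> verts G \<Longrightarrow> v \<in> verts G \<Longrightarrow> u \<rightarrow>\<^sup>*\<^bsub>G\<^esub> v"
  using connected reachable_mk_symmetric_eq[OF sym_arcs]
  by (auto simp: connected_def strongly_connected_def)

lemma out_degree_pos:
  assumes "u \<in> verts G"
  shows "out_degree G u > 0"
proof -
  have "card (verts G) \<ge> 2" using length_ge_2 distinct set_vs by (metis distinct_card)
  then have "\<not> verts G \<subseteq> {u}" using card_mono[of "{u}" "verts G"] by auto
  then obtain v where "v \<in> verts G" "v \<noteq> u" by auto
  with reachable[OF assms] obtain w where "u \<rightarrow>\<^bsub>G\<^esub> w"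
    by (metis converse_reachable_cases)
  then have "{v \<in> verts G. u \<rightarrow>\<^bsub>G\<^esub> v} \<noteq> {}" using adj_in_verts by blast
  then show ?thesis unfolding out_degree_eq_card by (simp add: card_gt_0_iff)
qed

lemma deg_pos: "i < length vs \<Longrightarrow> deg i > 0"
  using out_degree_pos[of "vs ! i"] nth_mem set_vs by auto

section \<open>Entries and traces of the normalized Laplacian\<close>

lemma L_carrier: "L \<in> carrier_mat (length vs) (length vs)"
  by (intro carrier_matI) (simp_all add: normalized_laplacian_def degree_matrix_inv_sqrt_def mat_diag_def)

lemma L_index:
  assumes "i < length vs" "j < length vs"
  shows "L $$ (i, j) = ((if i = j then deg i else 0) - adj i j) / (sqrt (deg i) * sqrt (deg j))"
proof -
  let ?n = "length vs"
  have s: "x powr (- 1 / 2) = 1 / sqrt x" if "x > 0" for x :: real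
    using that powr_minus_divide[of x "1 / 2"] by (simp add: powr_half_sqrt)
  have D: "degree_matrix G vs - adjacency_matrix G vs \<in> carrier_mat ?n ?n"
    by (intro carrier_matI) (simp_all add: adjacency_matrix_def)
  have "L $$ (i, j) = deg i powr (- 1 / 2) * ((if i = j then deg i else 0) - adj i j) * deg j powr (- 1 / 2)"
    unfolding normalized_laplacian_def degree_matrix_inv_sqrt_def mat_diag_mult_left[OF D]
    using assms by (subst mat_diag_mult_right[of _ ?n ?n])
      (auto simp: degree_matrix_def adjacency_matrix_def mat_diag_def)
  then show ?thesis unfolding s[OF deg_pos[OF assms(1)]] s[OF deg_pos[OF assms(2)]] by simp
qed

lemma L_sym: "i < length vs \<Longrightarrow> j < length vs \<Longrightarrow> L $$ (i, j) = L $$ (j, i)"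
  by (auto simp: L_index adjacent_commute mult.commute)

lemma adj_self: "adj i i = 0"
  using adj_not_same by auto

lemma trace_L: "(\<Sum>i = 0..<length vs. L $$ (i, i)) = real (length vs)"
proof -
  have "(\<Sum>i = 0..<length vs. L $$ (i, i)) = (\<Sum>i = 0..<length vs. 1)"
  proof (intro sum.cong refl)
    fix i assume "i \<in> {0..<length vs}"
    then show "L $$ (i, i) = 1"
      using deg_pos[of i] adj_self[of i] by (simp add: L_index del: if_cancel)
  qed
  then show ?thesis by simp
qed

text \<open>The fibre over an edge consists of its two orientations, which are distinct because
  there are no loops and contribute equal terms.\<close>

lemma sum_arcs_ends_eq_sum_edges:
  "(\<Sum>(u, v)\<in>arcs_ends G. 1 / (real (out_degree G u) * real (out_degree G v)))
     = 2 * (\<Sum>e\<in>undirected_edges G. 1 / (\<Prod>v\<in>e. real (out_degree G v)))"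
proof -
  let ?g = "\<lambda>(u, v). 1 / (real (out_degree G u) * real (out_degree G v))"
  let ?f = "\<lambda>(u, v). {u, v}"
  have fin: "finite (arcs_ends G)" by (simp add: arcs_ends_def)
  have im: "undirected_edges G = ?f ` arcs_ends G" unfolding undirected_edges_def by auto
  have "(\<Sum>p\<in>arcs_ends G. ?g p) = (\<Sum>e\<in>?f ` arcs_ends G. \<Sum>p\<in>{p \<in> arcs_ends G. ?f p = e}. ?g p)"
    by (rule sum.image_gen[OF fin])
  also have "\<dots> = (\<Sum>e\<in>undirected_edges G. 2 * (1 / (\<Prod>v\<in>e. real (out_degree G v))))"
    unfolding im
  proof (intro sum.cong refl)
    fix e assume "e \<in> ?f ` arcs_ends G"
    then obtain u v where uv: "u \<rightarrow>\<^bsub>G\<^esub> v" "e = {u, v}" by auto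
    have ne: "u \<noteq> v" using uv adj_not_same by auto
    have "{p \<in> arcs_ends G. ?f p = e} = {(u, v), (v, u)}"
    proof (rule Set.set_eqI)
      fix p :: "'a \<times> 'a"
      obtain x y where p: "p = (x, y)" by (cases p)
      show "p \<in> {p \<in> arcs_ends G. ?f p = e} \<longleftrightarrow> p \<in> {(u, v), (v, u)}"
        using uv(1) adjacent_commute[THEN iffD1, OF uv(1)]
        unfolding uv(2) p mem_Collect_eq case_prod_conv doubleton_eq_iff by blast
    qed
    then have "(\<Sum>p\<in>{p \<in> arcs_ends G. ?f p = e}. ?g p) = (\<Sum>p\<in>{(u, v), (v, u)}. ?g p)"
      by (simp only:)
    also have "\<dots> = 2 * (1 / (real (out_degree G u) * real (out_degree G v)))"
      using ne by (simp add: mult.commute[of "real (out_degree G v)"])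
    also have "\<dots> = 2 * (1 / (\<Prod>v\<in>e. real (out_degree G v)))"
      using ne by (simp add: uv(2))
    finally show "(\<Sum>p\<in>{p \<in> arcs_ends G. ?f p = e}. ?g p) = 2 * (1 / (\<Prod>v\<in>e. real (out_degree G v)))" .
  qed
  finally show ?thesis by (simp add: sum_distrib_left)
qed

text \<open>This is where \<open>b\<close> comes from: the unit diagonal contributes the number of
  vertices, and an adjacent ordered pair contributes the reciprocal product of its degrees.\<close>

lemma trace_L_square:
  "(\<Sum>i = 0..<length vs. \<Sum>j = 0..<length vs. L $$ (i, j) * L $$ (j, i))
     = real (length vs) + 2 * (\<Sum>e\<in>undirected_edges G. 1 / (\<Prod>v\<in>e. real (out_degree G v)))"
proof -
  let ?n = "length vs"
  let ?g = "\<lambda>u v. (if u \<rightarrow>\<^bsub>G\<^esub> v then 1 else 0) / (real (out_degree G u) * real (out_degree G v))"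
  have entry: "L $$ (i, j) * L $$ (j, i) = (if j = i then 1 else 0) + ?g (vs ! i) (vs ! j)"
    if "i < ?n" "j < ?n" for i j
  proof (cases "i = j")
    case True
    then show ?thesis using that deg_pos[of i] adj_not_same[of "vs ! i"] by (auto simp: L_index)
  next
    case False
    have "sqrt (deg i) * sqrt (deg j) * (sqrt (deg j) * sqrt (deg i))
        = (sqrt (deg i) * sqrt (deg i)) * (sqrt (deg j) * sqrt (deg j))" by (simp only: mult_ac)
    then have "sqrt (deg i) * sqrt (deg j) * (sqrt (deg j) * sqrt (deg i)) = deg i * deg j" by simp
    then show ?thesis using False that adjacent_commute[of "vs ! i" "vs ! j"] by (auto simp: L_index)
  qed
  have "(\<Sum>i = 0..<?n. \<Sum>j = 0..<?n. L $$ (i, j) * L $$ (j, i))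
      = (\<Sum>i = 0..<?n. (\<Sum>j = 0..<?n. if j = i then 1 else 0) + (\<Sum>j = 0..<?n. ?g (vs ! i) (vs ! j)))"
    unfolding sum.distrib[symmetric] by (intro sum.cong refl entry) auto
  also have "\<dots> = real ?n + (\<Sum>i = 0..<?n. \<Sum>j = 0..<?n. ?g (vs ! i) (vs ! j))"
    unfolding sum.distrib by simp
  also have "(\<Sum>i = 0..<?n. \<Sum>j = 0..<?n. ?g (vs ! i) (vs ! j)) = (\<Sum>u\<in>verts G. \<Sum>v\<in>verts G. ?g u v)"
    unfolding sum_nth_eq_sum_verts[of "\<lambda>v. ?g _ v"] sum_nth_eq_sum_verts[of "\<lambda>u. \<Sum>v\<in>verts G. ?g u v"] ..
  also have "\<dots> = (\<Sum>(u, v)\<in>verts G \<times> verts G. ?g u v)"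
    by (rule sum.cartesian_product)
  also have "\<dots> = (\<Sum>(u, v)\<in>arcs_ends G. 1 / (real (out_degree G u) * real (out_degree G v)))"
    using adj_in_verts by (intro sum.mono_neutral_cong_right) auto
  finally show ?thesis unfolding sum_arcs_ends_eq_sum_edges .
qed

section \<open>Quadratic form and kernel of the normalized Laplacian\<close>

lemma L_mult_index:
  assumes "v \<in> carrier_vec (length vs)" "i < length vs"
  shows "(L *\<^sub>v v) $ i = (\<Sum>j = 0..<length vs.
    ((if i = j then \<Sum>k = 0..<length vs. adj i k else 0) - adj i j) * (v $ j / sqrt (deg j))) / sqrt (deg i)"
  unfolding mult_mat_vec_index_sum[OF L_carrier assms] sum_divide_distrib
  unfolding deg_eq_sum_adj[symmetric]
  using assms by (intro sum.cong refl) (simp add: L_index mult.commute)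

text \<open>Moving both factors \<open>1 / sqrt (deg i)\<close> onto the vector leaves the form of
  the unnormalized Laplacian at the rescaled entries.\<close>

lemma L_quadratic_form:
  assumes "v \<in> carrier_vec (length vs)"
  shows "(\<Sum>i = 0..<length vs. v $ i * (L *\<^sub>v v) $ i)
    = (\<Sum>i = 0..<length vs. \<Sum>j = 0..<length vs.
        adj i j * (v $ i / sqrt (deg i) - v $ j / sqrt (deg j))\<^sup>2) / 2"
  using assms laplacian_quadratic_form[of "length vs" adj "\<lambda>i. v $ i / sqrt (deg i)"]
  by (simp add: L_mult_index adjacent_commute del: index_mult_mat_vec)

lemma L_eigenvalue_nonneg:
  assumes "eigenvalue L e"
  shows "e \<ge> 0"
proof -
  obtain v where v: "v \<in> carrier_vec (length vs)" "v \<noteq> 0\<^sub>v (length vs)" "L *\<^sub>v v = e \<cdot>\<^sub>v v"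
    using assms L_carrier unfolding eigenvalue_def eigenvector_def by auto
  have "0 \<le> (\<Sum>i = 0..<length vs. v $ i * (L *\<^sub>v v) $ i)"
    unfolding L_quadratic_form[OF v(1)] by (intro divide_nonneg_pos sum_nonneg) auto
  also have "\<dots> = e * (\<Sum>i = 0..<length vs. (v $ i)\<^sup>2)"
    using v by (simp add: sum_distrib_left power2_eq_square mult_ac)
  finally have "0 \<le> e * (\<Sum>i = 0..<length vs. (v $ i)\<^sup>2)" .
  moreover obtain i where "i < length vs" "v $ i \<noteq> 0"
    using v(1,2) by (metis eq_vecI carrier_vecD index_zero_vec)
  then have "(\<Sum>i = 0..<length vs. (v $ i)\<^sup>2) > 0" by (intro sum_pos2[of _ i]) auto
  ultimately show ?thesis by (simp add: zero_le_mult_iff)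
qed

text \<open>Division of each entry by \<open>sqrt (deg i)\<close> makes this vector constant; it
  spans the kernel of \<open>L\<close>.\<close>

definition sqrt_deg :: "real vec" where "sqrt_deg = vec (length vs) (\<lambda>i. sqrt (deg i))"

lemma sqrt_deg_carrier: "sqrt_deg \<in> carrier_vec (length vs)"
  by (simp add: sqrt_deg_def)

lemma L_eigenvalue_0: "eigenvalue L 0"
proof -
  have "(L *\<^sub>v sqrt_deg) $ i = 0" if i: "i < length vs" for i
  proof -
    have "(\<Sum>j = 0..<length vs. ((if i = j then \<Sum>k = 0..<length vs. adj i k else 0) - adj i j)
            * (sqrt_deg $ j / sqrt (deg j)))
        = (\<Sum>j = 0..<length vs. (if j = i then \<Sum>k = 0..<length vs. adj i k else 0) - adj i j)"
    proof (intro sum.cong refl)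
      fix j assume "j \<in> {0..<length vs}"
      then have "sqrt_deg $ j / sqrt (deg j) = 1" using deg_pos[of j] by (simp add: sqrt_deg_def)
      then show "((if i = j then \<Sum>k = 0..<length vs. adj i k else 0) - adj i j) * (sqrt_deg $ j / sqrt (deg j))
          = (if j = i then \<Sum>k = 0..<length vs. adj i k else 0) - adj i j"
        by (simp only: mult_1_right eq_commute[of i j])
    qed
    also have "\<dots> = 0" using i by (simp add: sum_subtractf)
    finally show ?thesis unfolding L_mult_index[OF sqrt_deg_carrier i] by simp
  qed
  then have "L *\<^sub>v sqrt_deg = 0 \<cdot>\<^sub>v sqrt_deg"
    using L_carrier sqrt_deg_carrier by (intro eq_vecI) (auto simp del: index_mult_mat_vec)
  moreover have "0 < length vs" using length_ge_2 by linarith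
  then have "sqrt_deg $ 0 \<noteq> 0\<^sub>v (length vs) $ 0"
    using deg_pos[of 0] by (simp add: sqrt_deg_def)
  then have "sqrt_deg \<noteq> 0\<^sub>v (length vs)" by metis
  ultimately show ?thesis
    using L_carrier sqrt_deg_carrier unfolding eigenvalue_def eigenvector_def by auto
qed

text \<open>A kernel vector annihilates the quadratic form, so all its nonnegative terms vanish and
  \<open>u\<close> agrees along every edge; connectedness makes \<open>u\<close> constant.\<close>

lemma L_kernel:
  assumes v: "v \<in> carrier_vec (length vs)" and 0: "L *\<^sub>v v = 0\<^sub>v (length vs)"
  shows "\<exists>c. v = c \<cdot>\<^sub>v sqrt_deg"
proof -
  define u where "u i = v $ i / sqrt (deg i)" for i
  have "(\<Sum>i = 0..<length vs. \<Sum>j = 0..<length vs. adj i j * (u i - u j)\<^sup>2) = 0"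
    using L_quadratic_form[OF v] unfolding 0 u_def by simp
  then have "\<forall>i\<in>{0..<length vs}. (\<Sum>j = 0..<length vs. adj i j * (u i - u j)\<^sup>2) = 0"
    by (subst (asm) sum_nonneg_eq_0_iff) (auto intro: sum_nonneg)
  then have "\<forall>i\<in>{0..<length vs}. \<forall>j\<in>{0..<length vs}. adj i j * (u i - u j)\<^sup>2 = 0"
    by (subst (asm) sum_nonneg_eq_0_iff) auto
  then have edge: "u i = u j" if "i < length vs" "j < length vs" "vs ! i \<rightarrow>\<^bsub>G\<^esub> vs ! j" for i j
  proof -
    have "adj i j * (u i - u j)\<^sup>2 = 0"
      using \<open>\<forall>i\<in>_. \<forall>j\<in>_. _ = 0\<close> that(1,2) by (meson atLeastLessThan_iff zero_le)
    then show ?thesis using that(3) by simp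
  qed
  \<comment> \<open>Reachability concerns vertices and \<open>u\<close> concerns positions, hence
    the quantifier over positions of \<open>w\<close>; in the base case distinctness leaves only
    position 0.\<close>
  have spread: "\<forall>j<length vs. vs ! j = w \<longrightarrow> u j = u 0" if "vs ! 0 \<rightarrow>\<^sup>*\<^bsub>G\<^esub> w" for w
    using that
  proof (induction rule: reachable_induct)
    case base
    show ?case
    proof (intro allI impI)
      fix j assume "j < length vs" "vs ! j = vs ! 0"
      then have "j = 0" using nth_eq_iff_index_eq[OF distinct, of j 0] length_ge_2 by linarith
      then show "u j = u 0" by simp
    qed
  next
    case (step x y)
    then obtain i where "i < length vs" "vs ! i = x"
      using adj_in_verts set_vs by (metis in_set_conv_nth)
    then show ?case using step edge by metis
  qed
  have u: "u j = u 0" if "j < length vs" for j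
  proof -
    have "0 < length vs" using length_ge_2 by linarith
    then have "vs ! 0 \<in> verts G" "vs ! j \<in> verts G" using that set_vs nth_mem by blast+
    then show ?thesis using spread[OF reachable] that by blast
  qed
  have "v = u 0 \<cdot>\<^sub>v sqrt_deg"
  proof (intro eq_vecI)
    fix i assume "i < dim_vec (u 0 \<cdot>\<^sub>v sqrt_deg)"
    then have i: "i < length vs" by (simp add: sqrt_deg_def)
    then show "v $ i = (u 0 \<cdot>\<^sub>v sqrt_deg) $ i"
      using u[OF i] deg_pos[OF i] by (auto simp: sqrt_deg_def u_def field_simps)
  qed (use v in \<open>auto simp: sqrt_deg_def\<close>)
  then show ?thesis by blast
qed

text \<open>Zero is an eigenvalue, none is negative, and zero is a simple root, so it occurs once,
  at the end. Dropping it changes neither the sum nor the sum of squares, which are the traces of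
  \<open>L\<close> and of its square.\<close>

lemma eigenvalues_desc_L:
  obtains ys where "eigenvalues_desc L = ys @ [0]" "length ys = length vs - 1"
    "sorted_wrt (\<ge>) ys" "\<And>y. y \<in> set ys \<Longrightarrow> y > 0"
    "sum_list ys = real (length vs)"
    "(\<Sum>y\<leftarrow>ys. y\<^sup>2)
       = real (length vs) + 2 * (\<Sum>e\<in>undirected_edges G. 1 / (\<Prod>v\<in>e. real (out_degree G v)))"
proof -
  define xs where "xs = eigenvalues_desc L"
  note eig = char_poly_eigenvalues_desc[OF L_carrier L_sym] length_eigenvalues_desc[OF L_carrier L_sym]
    set_eigenvalues_desc[OF L_carrier L_sym]
  have sorted: "sorted_wrt (\<ge>) xs"
    unfolding xs_def eigenvalues_desc_def by (simp add: sorted_wrt_rev)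
  have "xs \<noteq> []" using eig(2) length_ge_2 unfolding xs_def by auto
  then obtain ys x where xs: "xs = ys @ [x]" by (cases xs rule: rev_cases) auto
  have nonneg: "y \<ge> 0" if "y \<in> set xs" for y
    using that L_eigenvalue_nonneg eig(3) unfolding xs_def by blast
  have "0 \<in> set xs" using L_eigenvalue_0 eig(3) unfolding xs_def by blast
  then have "x \<le> 0" using sorted unfolding xs by (auto simp: sorted_wrt_append)
  then have x: "x = 0" using nonneg xs by force
  have "0 \<notin> set ys"
  proof
    assume "0 \<in> set ys"
    \<comment> \<open>Moving this zero and the final one to the front of the product would exhibit a
      double root at zero.\<close>
    then obtain p q where pq: "ys = p @ 0 # q" by (metis split_list)
    have "char_poly L = (\<Prod>e\<leftarrow>xs. [:- e, 1:])" unfolding xs_def by (rule eig(1))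
    also have "\<dots> = (\<Prod>e\<leftarrow>0 # 0 # (p @ q). [:- e, 1:])"
      unfolding xs x pq by (simp add: mult_ac)
    finally show False using symmetric_zero_root_simple[OF L_carrier L_sym L_kernel sqrt_deg_carrier] by blast
  qed
  then have pos: "y > 0" if "y \<in> set ys" for y
    using nonneg[of y] that unfolding xs by (metis Un_iff order_le_less set_append)
  show ?thesis
  proof (rule that[of ys])
    show "eigenvalues_desc L = ys @ [0]" using xs x by (simp add: xs_def)
    then show "length ys = length vs - 1" using eig(2) by simp
    show "sorted_wrt (\<ge>) ys" using sorted unfolding xs by (simp add: sorted_wrt_append)
    show "sum_list ys = real (length vs)"
      using sum_char_poly_roots[OF L_carrier eig(1)] unfolding trace_L xs_def[symmetric] xs x by simp
    show "(\<Sum>y\<leftarrow>ys. y\<^sup>2)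
       = real (length vs) + 2 * (\<Sum>e\<in>undirected_edges G. 1 / (\<Prod>v\<in>e. real (out_degree G v)))"
      using sum_squares_char_poly_roots[OF L_carrier eig(1)]
      unfolding trace_L_square xs_def[symmetric] xs x by simp
  qed (use pos in auto)
qed

end

section \<open>Power sum bounds for a connected graph\<close>

theorem mainTheorem3:
  fixes G :: "('a, 'b) pre_digraph" and vs :: "'a list" and n :: nat
    and b Q \<alpha> :: real and h :: int
  assumes "graph G" and "Digraph_Component.connected G"
    and "distinct vs" and "set vs = verts G"
    and "n = card (verts G)" and "n \<ge> 3"
    and "b = real n + 2 * (\<Sum>e\<in>undirected_edges G. 1 / (\<Prod>v\<in>e. real (out_degree G v)))"
    and "b \<noteq> (real n)\<^sup>2 / (real n - 1)"
    and "h = \<lfloor>(real n)\<^sup>2 / b\<rfloor>"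
    and "Q = 1 / (1 + real_of_int h)
               * (real n + sqrt ((b * (real_of_int h + 1) - (real n)\<^sup>2) / real_of_int h))"
    and "\<alpha> \<noteq> 0" and "\<alpha> \<noteq> 1"
  shows "(\<alpha> < 0 \<or> \<alpha> > 1 \<longrightarrow>
            nl_power_sum G vs \<alpha>
              \<ge> Q powr \<alpha> + (real n - Q) powr \<alpha> / (real n - 2) powr (\<alpha> - 1))
       \<and> (0 < \<alpha> \<and> \<alpha> < 1 \<longrightarrow>
            nl_power_sum G vs \<alpha>
              \<le> Q powr \<alpha> + (real n - Q) powr \<alpha> / (real n - 2) powr (\<alpha> - 1))"
proof -
  interpret graph G by fact
  have len: "length vs = n" using assms(3-5) by (metis distinct_card)
  interpret enumerated_connected_graph G vs
    using assms len by unfold_locales auto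
  obtain ys where ys: "eigenvalues_desc L = ys @ [0]" "length ys = n - 1" "sorted_wrt (\<ge>) ys"
    "\<And>y. y \<in> set ys \<Longrightarrow> y > 0" "sum_list ys = real n" "(\<Sum>y\<leftarrow>ys. y\<^sup>2) = b"
    using eigenvalues_desc_L unfolding len assms(7)[symmetric] by metis
  \<comment> \<open>By \<open>n \<ge> 3\<close> at least one entry stands beside the largest, so
    there are eigenvalues to share \<open>real n - Q\<close>.\<close>
  obtain M zs where Mzs: "ys = M # zs" "zs \<noteq> []" "length zs = n - 2"
  proof (cases ys)
    case (Cons M zs)
    then show ?thesis using ys(2) \<open>n \<ge> 3\<close> by (intro that[of M zs]) auto
  qed (use ys(2) \<open>n \<ge> 3\<close> in auto)
  have power_sum: "nl_power_sum G vs \<alpha> = (\<Sum>y\<leftarrow>ys. y powr \<alpha>)"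
  proof -
    have "nl_power_sum G vs \<alpha> = (\<Sum>i = 1..n - 1. (ys @ [0]) ! (i - 1) powr \<alpha>)"
      unfolding nl_power_sum_def nl_eigenvalue_def ys(1) len ..
    \<comment> \<open>Eigenvalues are counted from 1, list positions from 0; the range stops just
      before the final zero.\<close>
    also have "\<dots> = (\<Sum>i = 0..<n - 1. (ys @ [0]) ! i powr \<alpha>)"
      by (rule sum.reindex_bij_witness[of _ Suc "\<lambda>i. i - 1"]) auto
    also have "\<dots> = (\<Sum>i = 0..<n - 1. ys ! i powr \<alpha>)"
      using ys(2) by (intro sum.cong) (auto simp: nth_append)
    finally show ?thesis using ys(2) by (simp add: sum_list_sum_nth)
  qed
  have n: "real n \<ge> 3" using \<open>n \<ge> 3\<close> by simp
  \<comment> \<open>Cauchy-Schwarz for the \<open>n - 1\<close> positive eigenvalues. The excluded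
    value of \<open>b\<close> is the equality case, and strictness yields
    \<open>h \<le> n - 2\<close>.\<close>
  have "(real n)\<^sup>2 \<le> (real n - 1) * b"
    using sum_list_square_lower[of ys] ys(2,5,6) n by (simp add: of_nat_diff)
  moreover have "(real n)\<^sup>2 \<noteq> (real n - 1) * b"
    using assms(8) n by (simp add: field_simps)
  ultimately have b_gt: "(real n)\<^sup>2 < (real n - 1) * b" by simp
  then have "0 < (real n - 1) * b" by (smt (verit) zero_le_power2)
  then have b0: "b > 0" using n by (simp add: zero_less_mult_iff)
  \<comment> \<open>This ensures \<open>h \<ge> 1\<close>, so that the division by \<open>h\<close>
    in \<open>Q\<close> is a genuine one.\<close>
  have "b \<le> (real n)\<^sup>2"
    using sum_list_square_upper[of ys] ys(4-6) by (force intro: less_imp_le)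
  then have "1 \<le> (real n)\<^sup>2 / b" using b0 by simp
  then have h1: "h \<ge> 1" unfolding assms(9) by linarith
  have "(real n)\<^sup>2 / b < real n - 1" using b_gt b0 by (simp add: field_simps)
  then have h2: "1 + real_of_int h \<le> real n - 1"
  proof -
    have "h < int n - 1" unfolding assms(9) floor_less_iff
      using \<open>(real n)\<^sup>2 / b < real n - 1\<close> by simp
    then show ?thesis by linarith
  qed
  have "(real n)\<^sup>2 / b < real_of_int h + 1" unfolding assms(9) by linarith
  then have "b * (real_of_int h + 1) - (real n)\<^sup>2 \<ge> 0" using b0 by (simp add: field_simps)
  \<comment> \<open>Dropping this root from \<open>Q\<close> leaves \<open>n / (1 + h)\<close>,
    which is at least the mean \<open>n / (n - 1)\<close> of the positive eigenvalues.\<close>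
  then have "sqrt ((b * (real_of_int h + 1) - (real n)\<^sup>2) / real_of_int h) \<ge> 0" using h1 by simp
  then have "real n / (1 + real_of_int h) \<le> Q"
    unfolding assms(10) using h1 by (simp add: divide_right_mono)
  moreover have "real n / (real n - 1) \<le> real n / (1 + real_of_int h)"
    using h1 h2 n by (intro divide_left_mono) auto
  ultimately have Q1: "real n / (real n - 2 + 1) \<le> Q" by simp
  have Q2: "Q \<le> M"
    unfolding assms(10)
  proof (rule max_ge_of_sum_and_sum_squares[OF _ ys(5) _ ys(6) b0 assms(9) h1])
    show "0 \<le> x \<and> x \<le> M" if "x \<in> set ys" for x
      using that ys(3) ys(4)[of x] unfolding Mzs by (auto intro: less_imp_le)
  qed (use n in simp)
  \<comment> \<open>Used with \<open>c = 1\<close> for the convex exponents and with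
    \<open>c = - 1\<close> for the concave ones, where it reverses the inequality.\<close>
  have bound: "c * (Q powr \<alpha> + (real n - Q) powr \<alpha> / (real n - 2) powr (\<alpha> - 1))
      \<le> c * nl_power_sum G vs \<alpha>" if "c * (\<alpha> * (\<alpha> - 1)) \<ge> 0" for c
    unfolding power_sum Mzs(1)
    using ys(4,5) Mzs(2,3) n Q1 Q2 unfolding Mzs(1)
    by (intro powr_sum_bound_of_max_ge[OF that]) auto
  show ?thesis
  proof (intro conjI impI)
    assume "\<alpha> < 0 \<or> \<alpha> > 1"
    then have "1 * (\<alpha> * (\<alpha> - 1)) \<ge> 0" by (auto simp: zero_le_mult_iff)
    from bound[OF this] show "nl_power_sum G vs \<alpha>
        \<ge> Q powr \<alpha> + (real n - Q) powr \<alpha> / (real n - 2) powr (\<alpha> - 1)" by simp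
  next
    assume "0 < \<alpha> \<and> \<alpha> < 1"
    then have "- 1 * (\<alpha> * (\<alpha> - 1)) \<ge> 0" by (simp add: mult_le_0_iff)
    from bound[OF this] show "nl_power_sum G vs \<alpha>
        \<le> Q powr \<alpha> + (real n - Q) powr \<alpha> / (real n - 2) powr (\<alpha> - 1)" by simp
  qed
qed

end
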